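(* In the dual-machine online power-down scheduling problem described in the context (with $E=\psi_b=\psi_\sigma=1$), every deterministic online algorithm has competitive ratio at least $2.1$; that is, for every deterministic online algorithm ALG there is an input satisfying the single-machine schedulability condition on which the energy cost of ALG is at least $2.1$ times the energy cost of an optimal offline single-machine schedule.
   Context: Problem. There are two identical machines available to the online algorithm. Each machine is at any time in one of the states sleep (OFF), idle, or busy. Switching a machine from sleep to idle or busy costs $E=1$; a busy machine consumes $\psi_b=1$ per unit time and an idle machine consumes $\psi_\sigma=1$ per unit time; a sleeping machine consumes nothing. Jobs $j=(a_j,d_j,c_j)$ arrive online at time $a_j$ (only then become known), must receive $c_j$ units of processing within $[a_j,d_j]$, may be preempted, but must be processed on a single machine (no migration). The input satisfies the single-machine schedulability condition: for every interval $(\ell,r)$, $\sum_{j:\,\ell\le a_j,\ d_j\le r} c_j\le r-\ell$. The cost of a schedule is its total energy consumption (turn-on costs plus busy and idle consumption). OPT denotes a minimum-energy offline feasible schedule of all jobs on a single machine. The competitive ratio of an online algorithm is the supremum over inputs of its cost divided by OPT's cost. *)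

theory Defs
  imports "HOL-Analysis.Analysis"
begin

record job =
  arrival :: real
  deadline :: real
  work :: real

text \<open>An input is the finite list of its jobs in order of arrival; a job is referred to by its
  position in that list, so that several jobs may have the same parameters.\<close>

definition schedulable :: "job list \<Rightarrow> bool" where
  "schedulable I \<longleftrightarrow> (\<forall>l r. l < r \<longrightarrow>
     (\<Sum>j \<in> {j. j < length I \<and> l \<le> arrival (I ! j) \<and> deadline (I ! j) \<le> r}. work (I ! j)) \<le> r - l)"

definition valid_input :: "job list \<Rightarrow> bool" where
  "valid_input I \<longleftrightarrow>
     sorted (map arrival I) \<and>
     (\<forall>x \<in> set I. 0 \<le> arrival x \<and> arrival x < deadline x \<and> 0 < work x) \<and>
     schedulable I"

datatype state = Sleep | Idle | Busy nat

text \<open>The history of one machine: asleep before time 0, and from then on constant on consecutive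
  half-open intervals, finitely many of which meet any bounded interval.  A machine may stay on
  forever; its consumption is then infinite.\<close>

definition machine_history :: "(real \<Rightarrow> state) \<Rightarrow> bool" where
  "machine_history s \<longleftrightarrow>
     (\<forall>t<0. s t = Sleep) \<and>
     (\<exists>\<tau> :: nat \<Rightarrow> real. \<tau> 0 = 0 \<and> strict_mono \<tau> \<and> filterlim \<tau> at_top sequentially \<and>
        (\<forall>n. \<forall>t \<in> {\<tau> n..<\<tau> (Suc n)}. s t = s (\<tau> n)))"

definition turn_ons :: "(real \<Rightarrow> state) \<Rightarrow> real set" where
  "turn_ons s = {t. s t \<noteq> Sleep \<and> (\<forall>\<^sub>F u in at_left t. s u = Sleep)}"

definition machine_energy :: "ennreal \<Rightarrow> ennreal \<Rightarrow> ennreal \<Rightarrow> (real \<Rightarrow> state) \<Rightarrow> ennreal" where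
  "machine_energy E \<psi>\<^sub>b \<psi>\<^sub>\<sigma> s =
     E * emeasure (count_space UNIV) (turn_ons s)
     + \<psi>\<^sub>b * emeasure lborel {t. \<exists>j. s t = Busy j}
     + \<psi>\<^sub>\<sigma> * emeasure lborel {t. s t = Idle}"

type_synonym schedule = "nat \<Rightarrow> real \<Rightarrow> state"

text \<open>In all that follows \<open>k\<close> is the number of machines; the machines are \<open>0, \<dots>, k - 1\<close>, and the
  values of a schedule at other indices are irrelevant.\<close>

definition energy :: "ennreal \<Rightarrow> ennreal \<Rightarrow> ennreal \<Rightarrow> nat \<Rightarrow> schedule \<Rightarrow> ennreal" where
  "energy E \<psi>\<^sub>b \<psi>\<^sub>\<sigma> k S = (\<Sum>m<k. machine_energy E \<psi>\<^sub>b \<psi>\<^sub>\<sigma> (S m))"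

definition feasible :: "nat \<Rightarrow> job list \<Rightarrow> schedule \<Rightarrow> bool" where
  "feasible k I S \<longleftrightarrow>
     (\<forall>m<k. machine_history (S m)) \<and>
     (\<forall>m<k. \<forall>t j. S m t = Busy j \<longrightarrow>
        j < length I \<and> arrival (I ! j) \<le> t \<and> t \<le> deadline (I ! j)) \<and>
     (\<forall>j<length I. \<exists>m<k.
        emeasure lborel {t. S m t = Busy j} = ennreal (work (I ! j)) \<and>
        (\<forall>m'<k. m' \<noteq> m \<longrightarrow> (\<forall>t. S m' t \<noteq> Busy j)))"

definition opt_energy :: "ennreal \<Rightarrow> ennreal \<Rightarrow> ennreal \<Rightarrow> job list \<Rightarrow> ennreal" where
  "opt_energy E \<psi>\<^sub>b \<psi>\<^sub>\<sigma> I = (INF S \<in> {S. feasible 1 I S}. energy E \<psi>\<^sub>b \<psi>\<^sub>\<sigma> 1 S)"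

text \<open>A deterministic online algorithm maps each input to a feasible schedule, and its behaviour
  up to time \<open>t\<close> is a function of the jobs that have arrived by time \<open>t\<close>.\<close>

definition online_algorithm :: "nat \<Rightarrow> (job list \<Rightarrow> schedule) \<Rightarrow> bool" where
  "online_algorithm k A \<longleftrightarrow>
     (\<forall>I. valid_input I \<longrightarrow> feasible k I (A I)) \<and>
     (\<forall>I I' t. valid_input I \<longrightarrow> valid_input I' \<longrightarrow>
        filter (\<lambda>x. arrival x \<le> t) I = filter (\<lambda>x. arrival x \<le> t) I' \<longrightarrow>
        (\<forall>m<k. \<forall>u\<le>t. A I m u = A I' m u))"

text \<open>The empty input, on which the optimum is 0, is excluded.\<close>

definition competitive_ratio ::
  "ennreal \<Rightarrow> ennreal \<Rightarrow> ennreal \<Rightarrow> nat \<Rightarrow> (job list \<Rightarrow> schedule) \<Rightarrow> ennreal" where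
  "competitive_ratio E \<psi>\<^sub>b \<psi>\<^sub>\<sigma> k A =
     (SUP I \<in> {I. valid_input I \<and> I \<noteq> []}. energy E \<psi>\<^sub>b \<psi>\<^sub>\<sigma> k (A I) / opt_energy E \<psi>\<^sub>b \<psi>\<^sub>\<sigma> I)"

end

theory Submission
  imports Defs
begin

text \<open>
  The optimum will always be on during a single interval.  Consider \<open>v\<close>, the cost of the algorithm
  minus 2.1 times that of the optimum, at the end of this interval.  The ski-rental adversary waits
  for both machines to be off and then releases a tiny job without slack; when the algorithm turns
  off after idling for time \<open>z < -v\<close>, this changes \<open>v\<close> into \<open>v + z + 1 - 2.1 z > 1 + 2.1 v\<close>, up to an
  error that is as small as the job; otherwise it has idled until \<open>v \<ge> 0\<close>.  The fixed point of this
  map is \<open>-1/1.1\<close>, about \<open>-0.909\<close>, so repeating it wins from any larger \<open>v\<close>.  A single tight job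
  only yields \<open>1 - 2.1 = -1.1\<close>, but a tiny job with slack 1 yields more, because the algorithm
  loses both by executing it early (the optimum postpones it) and by executing it late (a tight job
  then forces the second machine on).
\<close>

section \<open>Machine histories\<close>

text \<open>The least \<open>n\<close> with \<open>t < \<tau> n\<close> is a successor, because
  \<open>\<tau> 0 = 0 \<le> t\<close>; its predecessor is the wanted index.\<close>

lemma history_piece:
  fixes \<tau> :: "nat \<Rightarrow> real"
  assumes "\<tau> 0 = 0" "filterlim \<tau> at_top sequentially" "0 \<le> t"
  obtains n where "\<tau> n \<le> t" "t < \<tau> (Suc n)"
proof -
  have ex: "\<exists>n. t < \<tau> n"
    using assms(2) eventually_gt_at_top[of t] unfolding filterlim_iff eventually_sequentially
    by (metis order.refl)
  define N where "N = (LEAST n. t < \<tau> n)"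
  have N: "t < \<tau> N" unfolding N_def using ex by (rule LeastI_ex)
  then obtain n where n: "N = Suc n" using assms by (cases N) auto
  have "\<not> t < \<tau> n" using not_less_Least[of n "\<lambda>n. t < \<tau> n"] n unfolding N_def by simp
  then show thesis using that[of n] N n by auto
qed

lemma machine_history_Sleep: "machine_history (\<lambda>_. Sleep)"
  unfolding machine_history_def
  by (auto intro!: exI[of _ real] simp: strict_mono_def filterlim_real_sequentially)

text \<open>This is what half-open pieces provide: the infimum of the times at which a machine is in
  a given kind of state is itself such a time.\<close>

lemma machine_history_locally_constant_right:
  assumes "machine_history s"
  shows "\<exists>e>0. \<forall>u\<in>{t..<t + e}. s u = s t"
proof (cases "t < 0")
  case True
  then show ?thesis using assms
    by (intro exI[of _ "- t"]) (auto simp: machine_history_def)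
next
  case False
  obtain \<tau> :: "nat \<Rightarrow> real" where \<tau>: "\<tau> 0 = 0" "filterlim \<tau> at_top sequentially"
    and c: "\<And>n t. t \<in> {\<tau> n..<\<tau> (Suc n)} \<Longrightarrow> s t = s (\<tau> n)"
    using assms unfolding machine_history_def by blast
  obtain n where n: "\<tau> n \<le> t" "t < \<tau> (Suc n)" using history_piece[OF \<tau>, of t] False by (auto simp: not_less)
  show ?thesis
  proof (intro exI conjI ballI)
    show "0 < \<tau> (Suc n) - t" using n by simp
    fix u assume "u \<in> {t..<t + (\<tau> (Suc n) - t)}"
    then have "s u = s (\<tau> n)" using n by (intro c) simp
    also have "\<dots> = s t" using n by (intro c[symmetric]) simp
    finally show "s u = s t" .
  qed
qed

text \<open>A countable union of half-open pieces, together with the negative half-line if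
  \<open>Sleep\<close> satisfies \<open>P\<close>.\<close>

lemma sets_machine_history:
  assumes "machine_history s"
  shows "{t. P (s t)} \<in> sets lborel"
proof -
  obtain \<tau> :: "nat \<Rightarrow> real" where \<tau>: "\<tau> 0 = 0" "filterlim \<tau> at_top sequentially"
    and c: "\<And>n t. t \<in> {\<tau> n..<\<tau> (Suc n)} \<Longrightarrow> s t = s (\<tau> n)"
    using assms unfolding machine_history_def by blast
  have neg: "s t = Sleep" if "t < 0" for t
    using assms that unfolding machine_history_def by blast
  have "{t. P (s t)} = (if P Sleep then {..<0} else {}) \<union>
      (\<Union>n. if P (s (\<tau> n)) then {\<tau> n..<\<tau> (Suc n)} else {})" (is "?L = ?R")
  proof (intro set_eqI iffI)
    fix t assume t: "t \<in> ?L"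
    show "t \<in> ?R"
    proof (cases "t < 0")
      case True
      then show ?thesis using t neg by auto
    next
      case False
      obtain n where n: "\<tau> n \<le> t" "t < \<tau> (Suc n)" using history_piece[OF \<tau>(1,2), of t] False by (auto simp: not_less)
      then have "P (s (\<tau> n))" using t c[of t n] by auto
      then show ?thesis using n by auto
    qed
  next
    fix t assume t: "t \<in> ?R"
    then consider "P Sleep" "t < 0" | n where "P (s (\<tau> n))" "t \<in> {\<tau> n..<\<tau> (Suc n)}"
      by (auto split: if_splits)
    then show "t \<in> ?L"
    proof cases
      case 1
      then show ?thesis using neg[of t] by simp
    next
      case (2 n)
      then show ?thesis using c[of t n] by simp
    qed
  qed
  also have "\<dots> \<in> sets lborel" by auto
  finally show ?thesis .
qed

text \<open>The building block for explicit schedules: nested applications, with the latest time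
  outermost, describe a history that changes its state finitely often after a given prefix.\<close>

definition continue_with :: "state \<Rightarrow> real \<Rightarrow> (real \<Rightarrow> state) \<Rightarrow> real \<Rightarrow> state" where
  "continue_with c T s = (\<lambda>t. if t < T then s t else c)"

lemma machine_history_continue_with:
  assumes "machine_history s" "0 \<le> T"
  shows "machine_history (continue_with c T s)"
proof (cases "T = 0")
  case True
  then have "\<forall>t<0. continue_with c T s t = Sleep" "\<forall>t\<ge>0. continue_with c T s t = c"
    using assms by (auto simp: machine_history_def continue_with_def)
  then show ?thesis unfolding machine_history_def
    by (auto intro!: exI[of _ real] simp: strict_mono_def filterlim_real_sequentially)
next
  case False
  obtain \<tau> :: "nat \<Rightarrow> real" where \<tau>: "\<tau> 0 = 0" "filterlim \<tau> at_top sequentially" "strict_mono \<tau>"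
    and const: "\<And>n t. t \<in> {\<tau> n..<\<tau> (Suc n)} \<Longrightarrow> s t = s (\<tau> n)"
    using assms unfolding machine_history_def by blast
  have ex: "\<exists>n. T \<le> \<tau> n"
    using \<tau>(2) eventually_ge_at_top[of T] unfolding filterlim_iff eventually_sequentially
    by (metis order.refl)
  define N where "N = (LEAST n. T \<le> \<tau> n)"
  have N: "T \<le> \<tau> N" unfolding N_def using ex by (rule LeastI_ex)
  have less: "\<tau> n < T" if "n < N" for n
    using not_less_Least[of n "\<lambda>n. T \<le> \<tau> n"] that unfolding N_def by simp
  have "0 < N" using N \<tau>(1) False assms(2) by (cases N) auto
  \<comment> \<open>The breakpoints before \<open>T\<close> are kept and followed by
    \<open>T\<close>, \<open>T + 1\<close>, \<open>T + 2\<close> and so on, so that they still tend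
    to infinity. Since \<open>0 < T\<close>, the first one remains 0.\<close>
  define \<tau>' where "\<tau>' n = (if n < N then \<tau> n else T + real (n - N))" for n
  have "strict_mono \<tau>'"
  proof (rule strict_monoI_Suc)
    fix n
    show "\<tau>' n < \<tau>' (Suc n)"
      using less[of n] strict_monoD[OF \<tau>(3), of n "Suc n"]
      by (cases "Suc n" N rule: linorder_cases) (auto simp: \<tau>'_def Suc_diff_le)
  qed
  moreover have "filterlim \<tau>' at_top sequentially"
  proof (rule filterlim_at_top_mono)
    show "filterlim (\<lambda>n. (T - real N) + real n) at_top sequentially"
      by (rule filterlim_tendsto_add_at_top[OF tendsto_const filterlim_real_sequentially])
    show "\<forall>\<^sub>F n in sequentially. (T - real N) + real n \<le> \<tau>' n"
      using eventually_ge_at_top[of N] by eventually_elim (auto simp: \<tau>'_def of_nat_diff)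
  qed
  moreover have "continue_with c T s t = continue_with c T s (\<tau>' n)"
    if t: "t \<in> {\<tau>' n..<\<tau>' (Suc n)}" for n t
  proof (cases "n < N")
    case True
    then have "\<tau>' (Suc n) \<le> \<tau> (Suc n)" "\<tau>' (Suc n) \<le> T"
      using N less[of "Suc n"] by (cases "Suc n = N"; auto simp: \<tau>'_def)+
    then show ?thesis using t True less[of n] const[of t n]
      by (auto simp: \<tau>'_def continue_with_def)
  next
    case False
    then show ?thesis using t by (auto simp: \<tau>'_def continue_with_def)
  qed
  moreover have "\<tau>' 0 = 0" using \<open>0 < N\<close> \<tau>(1) by (simp add: \<tau>'_def)
  moreover have "\<forall>t<0. continue_with c T s t = Sleep"
    using assms by (auto simp: machine_history_def continue_with_def)
  ultimately show ?thesis
    unfolding machine_history_def by blast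
qed

text \<open>The infimum of the times from \<open>x\<close> on that satisfy \<open>Q\<close> is
  attained: \<open>Q\<close> holds arbitrarily closely to its right (or at it), and \<open>Q\<close>
  is locally constant to the right.\<close>

lemma first_time:
  fixes Q :: "real \<Rightarrow> bool"
  assumes "Q y" "x \<le> y" and right: "\<And>t. \<exists>e>0. \<forall>u\<in>{t..<t + e}. Q u = Q t"
  obtains w where "x \<le> w" "w \<le> y" "Q w" "\<And>u. x \<le> u \<Longrightarrow> u < w \<Longrightarrow> \<not> Q u"
proof -
  define X where "X = {u. x \<le> u \<and> Q u}"
  define w where "w = Inf X"
  have X: "X \<noteq> {}" "bdd_below X" "y \<in> X"
    using assms by (auto simp: X_def intro: bdd_belowI[of _ x])
  have lower: "w \<le> u" if "u \<in> X" for u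
    using that X(2) by (simp add: w_def cInf_lower)
  have "x \<le> w" unfolding w_def using X(1) by (intro cInf_greatest) (auto simp: X_def)
  obtain e where e: "e > 0" "\<forall>u\<in>{w..<w + e}. Q u = Q w" using right by blast
  obtain u where "u \<in> X" "u < w + e"
    using cInf_lessD[OF X(1), of "w + e"] e(1) by (auto simp: w_def)
  then have "Q u" "u \<in> {w..<w + e}" using lower[of u] by (auto simp: X_def)
  then have "Q w" using e(2) by blast
  moreover have "\<not> Q u" if "x \<le> u" "u < w" for u
    using lower[of u] that by (auto simp: X_def)
  ultimately show thesis using that \<open>x \<le> w\<close> lower[OF X(3)] by blast
qed

text \<open>The first time after \<open>x\<close> at which the machine is not asleep has only sleep
  between \<open>x\<close> and itself, hence is a turn-on.\<close>

lemma ex_turn_on: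
  assumes "machine_history s" "s x = Sleep" "s y \<noteq> Sleep" "x \<le> y"
  obtains t where "t \<in> turn_ons s" "x < t" "t \<le> y"
proof -
  have right: "\<exists>e>0. \<forall>u\<in>{t..<t + e}. (s u \<noteq> Sleep) = (s t \<noteq> Sleep)" for t
    using machine_history_locally_constant_right[OF assms(1), of t] by metis
  obtain w where w: "x \<le> w" "w \<le> y" "s w \<noteq> Sleep" "\<And>u. x \<le> u \<Longrightarrow> u < w \<Longrightarrow> s u = Sleep"
    by (rule first_time[of "\<lambda>t. s t \<noteq> Sleep" y x, OF _ _ right]) (use assms in auto)
  have "x < w" using w(1,3) assms(2) by (cases "x = w") auto
  moreover have "\<forall>\<^sub>F u in at_left w. s u = Sleep"
    using eventually_at_left_real[OF \<open>x < w\<close>] by eventually_elim (auto intro: w(4))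
  ultimately show thesis using that[of w] w(2,3) by (simp add: turn_ons_def)
qed

section \<open>Energy spent before a given time\<close>

text \<open>With unit rates, busy and idle time need not be told apart. The cut is strict, so that
  the value depends only on what the machine does before \<open>T\<close>, hence only on jobs known
  before \<open>T\<close>.\<close>

definition energy_before :: "real \<Rightarrow> (real \<Rightarrow> state) \<Rightarrow> ennreal" where
  "energy_before T s = emeasure (count_space UNIV) (turn_ons s \<inter> {..<T})
     + emeasure lborel ({t. s t \<noteq> Sleep} \<inter> {..<T})"

lemma machine_energy_unit:
  assumes "machine_history s"
  shows "machine_energy 1 1 1 s
    = emeasure (count_space UNIV) (turn_ons s) + emeasure lborel {t. s t \<noteq> Sleep}"
proof -
  have "{t. s t \<noteq> Sleep} = {t. \<exists>j. s t = Busy j} \<union> {t. s t = Idle}"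
  proof (rule set_eqI)
    show "t \<in> {t. s t \<noteq> Sleep} \<longleftrightarrow> t \<in> {t. \<exists>j. s t = Busy j} \<union> {t. s t = Idle}" for t
      by (cases "s t") auto
  qed
  moreover have "emeasure lborel ({t. \<exists>j. s t = Busy j} \<union> {t. s t = Idle})
      = emeasure lborel {t. \<exists>j. s t = Busy j} + emeasure lborel {t. s t = Idle}"
    by (rule plus_emeasure[symmetric])
      (use sets_machine_history[OF assms, of "\<lambda>c. \<exists>j. c = Busy j"]
        sets_machine_history[OF assms, of "\<lambda>c. c = Idle"] in auto)
  ultimately show ?thesis by (simp add: machine_energy_def add.assoc)
qed

lemma energy_before_le:
  assumes "machine_history s"
  shows "energy_before T s \<le> machine_energy 1 1 1 s"
  unfolding machine_energy_unit[OF assms] energy_before_def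
  using sets_machine_history[OF assms, of "\<lambda>c. c \<noteq> Sleep"]
  by (intro add_mono emeasure_mono) auto

lemma energy_before_mono:
  assumes "machine_history s" "T \<le> T'"
  shows "energy_before T s \<le> energy_before T' s"
  unfolding energy_before_def
  using sets_machine_history[OF assms(1), of "\<lambda>c. c \<noteq> Sleep"] assms(2)
  by (intro add_mono emeasure_mono) auto

text \<open>Whether \<open>t\<close> is a turn-on depends only on times up to \<open>t\<close>. This
  carries energy bounds over from an input to its extension by a later job.\<close>

lemma energy_before_cong:
  assumes "\<And>t. t < T \<Longrightarrow> s t = s' t"
  shows "energy_before T s = energy_before T s'"
proof -
  have "(\<forall>\<^sub>F u in at_left t. s u = Sleep) = (\<forall>\<^sub>F u in at_left t. s' u = Sleep)" if "t < T" for t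
    by (rule eventually_cong[OF eventually_at_left_real[of "t - 1"]]) (use assms that in auto)
  then have "turn_ons s \<inter> {..<T} = turn_ons s' \<inter> {..<T}"
    using assms by (auto simp: turn_ons_def)
  moreover have "{t. s t \<noteq> Sleep} \<inter> {..<T} = {t. s' t \<noteq> Sleep} \<inter> {..<T}"
    using assms by auto
  ultimately show ?thesis by (simp add: energy_before_def)
qed

lemma energy_before_turn_on:
  assumes "machine_history s" "s x = Sleep" "s y \<noteq> Sleep" "T \<le> x" "x \<le> y" "y < T'"
  shows "energy_before T s + 1 \<le> energy_before T' s"
proof -
  obtain t where t: "t \<in> turn_ons s" "x < t" "t \<le> y"
    using ex_turn_on[OF assms(1-3,5)] .
  have "emeasure (count_space UNIV) (turn_ons s \<inter> {..<T}) + emeasure (count_space UNIV) {t}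
      = emeasure (count_space UNIV) (turn_ons s \<inter> {..<T} \<union> {t})"
    using t assms by (intro plus_emeasure) auto
  also have "\<dots> \<le> emeasure (count_space UNIV) (turn_ons s \<inter> {..<T'})"
    using t assms by (intro emeasure_mono) auto
  finally have "emeasure (count_space UNIV) (turn_ons s \<inter> {..<T}) + 1
      \<le> emeasure (count_space UNIV) (turn_ons s \<inter> {..<T'})" by simp
  moreover have "emeasure lborel ({t. s t \<noteq> Sleep} \<inter> {..<T})
      \<le> emeasure lborel ({t. s t \<noteq> Sleep} \<inter> {..<T'})"
    using sets_machine_history[OF assms(1), of "\<lambda>c. c \<noteq> Sleep"] assms
    by (intro emeasure_mono) auto
  ultimately show ?thesis unfolding energy_before_def
    by (metis (no_types, lifting) add.assoc add.commute add_mono)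
qed

lemma sum_energy_before_turn_on:
  fixes S :: schedule
  assumes "\<And>m. m < k \<Longrightarrow> machine_history (S m)" "m < k"
    and "S m x = Sleep" "S m y \<noteq> Sleep" "T \<le> x" "x \<le> y" "y < T'"
  shows "(\<Sum>m<k. energy_before T (S m)) + 1 \<le> (\<Sum>m<k. energy_before T' (S m))"
proof -
  have "(\<Sum>m<k. energy_before T (S m)) + 1
      = (energy_before T (S m) + 1) + (\<Sum>m\<in>{..<k} - {m}. energy_before T (S m))"
    using assms(2) by (subst sum.remove[of _ m]) (auto simp: ac_simps)
  also have "\<dots> \<le> energy_before T' (S m) + (\<Sum>m\<in>{..<k} - {m}. energy_before T' (S m))"
    using assms by (intro add_mono sum_mono energy_before_turn_on energy_before_mono) auto
  also have "\<dots> = (\<Sum>m<k. energy_before T' (S m))"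
    using assms(2) by (subst (2) sum.remove[of _ m]) auto
  finally show ?thesis .
qed

text \<open>The times at which the single machines are on cover \<open>[T, T')\<close>, so by
  subadditivity their measures add up to at least \<open>T' - T\<close>.\<close>

lemma sum_energy_before_on:
  fixes S :: schedule
  assumes hist: "\<And>m. m < k \<Longrightarrow> machine_history (S m)" and "T \<le> T'"
    and on: "\<And>t. T \<le> t \<Longrightarrow> t < T' \<Longrightarrow> \<exists>m<k. S m t \<noteq> Sleep"
  shows "(\<Sum>m<k. energy_before T (S m)) + ennreal (T' - T) \<le> (\<Sum>m<k. energy_before T' (S m))"
proof -
  let ?N = "\<lambda>m. {t. S m t \<noteq> Sleep}"
  have sets: "?N m \<in> sets lborel" if "m < k" for m
    using sets_machine_history[OF hist[OF that], of "\<lambda>c. c \<noteq> Sleep"] .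
  have step: "energy_before T (S m) + emeasure lborel (?N m \<inter> {T..<T'}) \<le> energy_before T' (S m)"
    if "m < k" for m
  proof -
    have "emeasure lborel (?N m \<inter> {..<T}) + emeasure lborel (?N m \<inter> {T..<T'})
        = emeasure lborel (?N m \<inter> {..<T} \<union> ?N m \<inter> {T..<T'})"
      using sets[OF that] by (intro plus_emeasure) auto
    also have "\<dots> \<le> emeasure lborel (?N m \<inter> {..<T'})"
      using sets[OF that] \<open>T \<le> T'\<close> by (intro emeasure_mono) auto
    finally have "emeasure lborel (?N m \<inter> {..<T}) + emeasure lborel (?N m \<inter> {T..<T'})
        \<le> emeasure lborel (?N m \<inter> {..<T'})" .
    moreover have "emeasure (count_space UNIV) (turn_ons (S m) \<inter> {..<T})
        \<le> emeasure (count_space UNIV) (turn_ons (S m) \<inter> {..<T'})"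
      using \<open>T \<le> T'\<close> by (intro emeasure_mono) auto
    ultimately show ?thesis unfolding energy_before_def add.assoc by (rule add_mono[rotated])
  qed
  have "ennreal (T' - T) = emeasure lborel {T..<T'}" using \<open>T \<le> T'\<close> by simp
  also have "\<dots> = emeasure lborel (\<Union>m<k. ?N m \<inter> {T..<T'})"
    using on by (intro arg_cong[of _ _ "emeasure lborel"]) fastforce
  also have "\<dots> \<le> (\<Sum>m<k. emeasure lborel (?N m \<inter> {T..<T'}))"
    using sets by (intro emeasure_subadditive_finite) auto
  finally have "(\<Sum>m<k. energy_before T (S m)) + ennreal (T' - T)
      \<le> (\<Sum>m<k. energy_before T (S m)) + (\<Sum>m<k. emeasure lborel (?N m \<inter> {T..<T'}))"
    by (intro add_left_mono)
  also have "\<dots> \<le> (\<Sum>m<k. energy_before T' (S m))"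
    unfolding sum.distrib[symmetric] using step by (intro sum_mono) auto
  finally show ?thesis .
qed

text \<open>A job may also run at the instant \<open>d\<close>, which \<open>energy_before d\<close>
  does not see; but \<open>{d}\<close> is a null set and cannot hold all of the work.\<close>

lemma ex_busy_time:
  fixes s :: "real \<Rightarrow> state"
  assumes "emeasure lborel {t. s t = Busy j} = ennreal w" "0 < w"
    and "\<And>t. s t = Busy j \<Longrightarrow> a \<le> t \<and> t \<le> d"
  obtains y where "s y = Busy j" "a \<le> y" "y < d"
proof -
  have "\<not> {t. s t = Busy j} \<subseteq> {d}"
  proof
    assume "{t. s t = Busy j} \<subseteq> {d}"
    then have "emeasure lborel {t. s t = Busy j} \<le> emeasure lborel {d}"
      by (intro emeasure_mono) auto
    then show False using assms by simp
  qed
  then obtain y where "s y = Busy j" "y \<noteq> d" by auto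
  then show thesis using that[of y] assms(3)[of y] by (simp add: order_less_le)
qed

lemma energy_before_busy:
  assumes hist: "machine_history s" and w: "emeasure lborel {t. s t = Busy j} = ennreal w" "0 < w"
    and d: "\<And>t. s t = Busy j \<Longrightarrow> a \<le> t \<and> t \<le> d"
  shows "1 + ennreal w \<le> energy_before d s"
proof -
  obtain y where y: "s y = Busy j" "y < d" using ex_busy_time[OF w d] by blast
  \<comment> \<open>A time before 0, where every machine is asleep, that is also at most
    \<open>y\<close>.\<close>
  define x where "x = min (-1) y"
  have "s x = Sleep" using hist by (auto simp: machine_history_def x_def)
  moreover have "s y \<noteq> Sleep" "x \<le> y" using y by (auto simp: x_def)
  ultimately obtain t where t: "t \<in> turn_ons s" "t \<le> y"
    using ex_turn_on[OF hist] by metis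
  have "emeasure (count_space UNIV) {t} \<le> emeasure (count_space UNIV) (turn_ons s \<inter> {..<d})"
    using t y by (intro emeasure_mono) auto
  then have on: "1 \<le> emeasure (count_space UNIV) (turn_ons s \<inter> {..<d})" by simp
  have m: "{t. s t \<noteq> Sleep} \<in> sets lborel" "{t. s t = Busy j} \<in> sets lborel"
    using sets_machine_history[OF hist, of "\<lambda>c. c \<noteq> Sleep"]
      sets_machine_history[OF hist, of "\<lambda>c. c = Busy j"] by auto
  have "ennreal w = emeasure lborel {t. s t = Busy j}" using w by simp
  also have "\<dots> \<le> emeasure lborel (({t. s t \<noteq> Sleep} \<inter> {..<d}) \<union> {d})"
    using m d by (intro emeasure_mono) (auto simp: less_eq_real_def)
  also have "\<dots> \<le> emeasure lborel ({t. s t \<noteq> Sleep} \<inter> {..<d}) + emeasure lborel {d}"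
    using m by (intro emeasure_subadditive) auto
  finally have "ennreal w \<le> emeasure lborel ({t. s t \<noteq> Sleep} \<inter> {..<d})" by simp
  then show ?thesis using on unfolding energy_before_def by (intro add_mono)
qed

section \<open>Single-machine schedules that are on during one interval\<close>

text \<open>The jobs that must run within \<open>[l, r]\<close> occupy disjoint subsets of it. Thus
  the schedule that bounds the optimum from above also certifies that the input of the adversary is
  valid.\<close>

lemma feasible_imp_schedulable:
  assumes "feasible 1 I S" "\<forall>x\<in>set I. 0 < work x"
  shows "schedulable I"
  unfolding schedulable_def
proof (intro allI impI)
  fix l r :: real assume "l < r"
  let ?J = "{j. j < length I \<and> l \<le> arrival (I ! j) \<and> deadline (I ! j) \<le> r}"
  let ?B = "\<lambda>j. {t. S 0 t = Busy j}"
  have hist: "machine_history (S 0)" using assms(1) by (auto simp: feasible_def)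
  have w: "emeasure lborel (?B j) = ennreal (work (I ! j))" if "j < length I" for j
    using assms(1) that by (auto simp: feasible_def)
  have sub: "?B j \<subseteq> {l..r}" if "j \<in> ?J" for j
    using assms(1) that unfolding feasible_def by fastforce
  have "ennreal (\<Sum>j\<in>?J. work (I ! j)) = (\<Sum>j\<in>?J. ennreal (work (I ! j)))"
    using assms(2) by (intro sum_ennreal[symmetric]) (auto intro: less_imp_le)
  also have "\<dots> = (\<Sum>j\<in>?J. emeasure lborel (?B j))" using w by (intro sum.cong) auto
  also have "\<dots> = emeasure lborel (\<Union>j\<in>?J. ?B j)"
    using sets_machine_history[OF hist, of "\<lambda>c. c = Busy _"]
    by (intro sum_emeasure) (auto simp: disjoint_family_on_def)
  also have "\<dots> \<le> emeasure lborel {l..r}"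
    using sub by (intro emeasure_mono) auto
  also have "\<dots> = ennreal (r - l)" using \<open>l < r\<close> by simp
  finally show "(\<Sum>j\<in>?J. work (I ! j)) \<le> r - l"
    using \<open>l < r\<close> by (simp add: ennreal_le_iff)
qed

lemma feasible_1:
  "feasible 1 I S \<longleftrightarrow> machine_history (S 0) \<and>
     (\<forall>t j. S 0 t = Busy j \<longrightarrow> j < length I \<and> arrival (I ! j) \<le> t \<and> t \<le> deadline (I ! j)) \<and>
     (\<forall>j<length I. emeasure lborel {t. S 0 t = Busy j} = ennreal (work (I ! j)))"
  by (auto simp: feasible_def)

definition tight_job :: "real \<Rightarrow> real \<Rightarrow> job" where
  "tight_job a d = \<lparr>arrival = a, deadline = d, work = d - a\<rparr>"

lemma tight_job_simps [simp]:
  "arrival (tight_job a d) = a" "deadline (tight_job a d) = d" "work (tight_job a d) = d - a"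
  by (simp_all add: tight_job_def)

text \<open>Existence of an offline schedule with a single turn-on, at \<open>\<sigma>\<close>, and
  hence of cost \<open>1 + (T - \<sigma>)\<close>. All upper bounds on the optimum come from such
  schedules.\<close>

definition feasible_on_interval :: "job list \<Rightarrow> real \<Rightarrow> real \<Rightarrow> bool" where
  "feasible_on_interval I \<sigma> T \<longleftrightarrow> \<sigma> < T \<and>
     (\<exists>S. feasible 1 I S \<and> (\<forall>t. S 0 t \<noteq> Sleep \<longleftrightarrow> \<sigma> \<le> t \<and> t < T))"

lemma opt_energy_le:
  assumes "feasible_on_interval I \<sigma> T"
  shows "opt_energy 1 1 1 I \<le> ennreal (1 + (T - \<sigma>))"
proof -
  obtain S where S: "feasible 1 I S" and on: "\<And>t. S 0 t \<noteq> Sleep \<longleftrightarrow> \<sigma> \<le> t \<and> t < T"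
    and "\<sigma> < T"
    using assms unfolding feasible_on_interval_def by blast
  have hist: "machine_history (S 0)" using S by (auto simp: feasible_def)
  have "turn_ons (S 0) \<subseteq> {\<sigma>}"
  proof
    fix t assume t: "t \<in> turn_ons (S 0)"
    then have "\<sigma> \<le> t" "t < T" using on by (auto simp: turn_ons_def)
    moreover have "\<not> \<sigma> < t"
    proof
      assume "\<sigma> < t"
      have "\<forall>\<^sub>F u in at_left t. S 0 u = Sleep" using t by (simp add: turn_ons_def)
      then have "\<forall>\<^sub>F u in at_left t. False"
        using eventually_at_left_real[OF \<open>\<sigma> < t\<close>]
        by eventually_elim (use on \<open>t < T\<close> in force)
      then show False by simp
    qed
    ultimately show "t \<in> {\<sigma>}" by simp
  qed
  then have "emeasure (count_space UNIV) (turn_ons (S 0)) \<le> emeasure (count_space UNIV) {\<sigma>}"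
    by (intro emeasure_mono) auto
  moreover have "{t. S 0 t \<noteq> Sleep} = {\<sigma>..<T}" by (simp add: on atLeastLessThan_def atLeast_def lessThan_def Int_def)
  ultimately have "machine_energy 1 1 1 (S 0) \<le> 1 + ennreal (T - \<sigma>)"
    unfolding machine_energy_unit[OF hist] using \<open>\<sigma> < T\<close> by (intro add_mono) simp_all
  also have "\<dots> = ennreal (1 + (T - \<sigma>))" using \<open>\<sigma> < T\<close> by (subst ennreal_plus) auto
  finally have "energy 1 1 1 1 S \<le> ennreal (1 + (T - \<sigma>))" by (simp add: energy_def)
  moreover have "opt_energy 1 1 1 I \<le> energy 1 1 1 1 S"
    unfolding opt_energy_def using S by (intro INF_lower) auto
  ultimately show ?thesis by (rule order.trans[rotated])
qed

text \<open>Instead of turning off at \<open>T\<close>, the machine idles until \<open>a\<close> and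
  then runs the new job. The optimum thus pays at most \<open>d - T\<close> more, with no further
  turn-on.\<close>

lemma feasible_on_interval_append:
  assumes "feasible_on_interval I \<sigma> T" "0 \<le> T" "T \<le> a" "a < d"
  shows "feasible_on_interval (I @ [tight_job a d]) \<sigma> d"
proof -
  obtain S where S: "feasible 1 I S" and on: "\<And>t. S 0 t \<noteq> Sleep \<longleftrightarrow> \<sigma> \<le> t \<and> t < T"
    and "\<sigma> < T"
    using assms unfolding feasible_on_interval_def by blast
  let ?n = "length I"
  define s where "s = continue_with Sleep d (continue_with (Busy ?n) a (continue_with Idle T (S 0)))"
  have hist: "machine_history s" unfolding s_def
    using S assms by (intro machine_history_continue_with) (auto simp: feasible_def)
  have s: "s t = (if t < T then S 0 t else if t < a then Idle else if t < d then Busy ?n else Sleep)"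
    for t using assms by (auto simp: s_def continue_with_def)
  have S_busy: "j < ?n \<and> arrival (I ! j) \<le> t \<and> t \<le> deadline (I ! j)" if "S 0 t = Busy j" for t j
    using S that by (auto simp: feasible_def)
  \<comment> \<open>From \<open>T\<close> on, the old schedule is asleep and the new one runs no old
    job.\<close>
  have old: "{t. s t = Busy j} = {t. S 0 t = Busy j}" if "j < ?n" for j
  proof (rule set_eqI)
    show "t \<in> {t. s t = Busy j} \<longleftrightarrow> t \<in> {t. S 0 t = Busy j}" for t
      using that on[of t] by (cases "t < T") (auto simp: s)
  qed
  have new: "{t. s t = Busy ?n} = {a..<d}"
  proof (rule set_eqI)
    show "t \<in> {t. s t = Busy ?n} \<longleftrightarrow> t \<in> {a..<d}" for t
      using S_busy[of t ?n] assms by (auto simp: s)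
  qed
  have "feasible 1 (I @ [tight_job a d]) (\<lambda>_. s)"
    unfolding feasible_1
  proof (intro conjI allI impI)
    show "j < length (I @ [tight_job a d])" "arrival ((I @ [tight_job a d]) ! j) \<le> t"
      "t \<le> deadline ((I @ [tight_job a d]) ! j)" if "s t = Busy j" for t j
      using that S_busy[of t j] by (auto simp: s nth_append split: if_splits)
    show "emeasure lborel {t. s t = Busy j} = ennreal (work ((I @ [tight_job a d]) ! j))"
      if j: "j < length (I @ [tight_job a d])" for j
    proof (cases "j < ?n")
      case True
      then show ?thesis using S[unfolded feasible_1] old[OF True] by (simp add: nth_append)
    next
      case False
      then have "j = ?n" using j by simp
      then show ?thesis using new \<open>a < d\<close> by simp
    qed
  qed (rule hist)
  moreover have "s t \<noteq> Sleep \<longleftrightarrow> \<sigma> \<le> t \<and> t < d" for t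
    using on[of t] assms \<open>\<sigma> < T\<close> by (auto simp: s)
  ultimately show ?thesis
    unfolding feasible_on_interval_def using assms \<open>\<sigma> < T\<close> by (intro conjI exI[of _ "\<lambda>_. s"]) auto
qed

lemma feasible_on_interval_single:
  assumes "arrival x \<le> \<sigma>" "\<sigma> + work x \<le> deadline x" "0 < work x" "0 \<le> \<sigma>"
  shows "feasible_on_interval [x] \<sigma> (\<sigma> + work x)"
proof -
  define s where "s = continue_with Sleep (\<sigma> + work x) (continue_with (Busy 0) \<sigma> (\<lambda>_. Sleep))"
  have hist: "machine_history s" unfolding s_def
    using assms by (intro machine_history_continue_with machine_history_Sleep) auto
  have s: "s t = (if \<sigma> \<le> t \<and> t < \<sigma> + work x then Busy 0 else Sleep)" for t
    using assms by (auto simp: s_def continue_with_def)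
  have "{t. s t = Busy 0} = {\<sigma>..<\<sigma> + work x}" by (auto simp: s)
  then have "feasible 1 [x] (\<lambda>_. s)"
    unfolding feasible_1 using hist assms by (auto simp: s)
  then show ?thesis unfolding feasible_on_interval_def
    using assms by (intro conjI exI[of _ "\<lambda>_. s"]) (auto simp: s)
qed

lemma valid_input_if_feasible_on_interval:
  assumes "feasible_on_interval I \<sigma> T" "sorted (map arrival I)"
    and "\<forall>x\<in>set I. 0 \<le> arrival x \<and> arrival x < deadline x \<and> 0 < work x"
  shows "valid_input I"
  using assms feasible_imp_schedulable unfolding valid_input_def feasible_on_interval_def by blast

lemma valid_input_append_tight_job:
  assumes "valid_input I" "feasible_on_interval (I @ [tight_job a d]) \<sigma> T"
    and "\<forall>x\<in>set I. arrival x \<le> a" "0 \<le> a" "a < d"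
  shows "valid_input (I @ [tight_job a d])"
  using assms
  by (intro valid_input_if_feasible_on_interval[OF assms(2)])
    (auto simp: valid_input_def sorted_append)

section \<open>The adversary\<close>

lemma online_feasible:
  assumes "online_algorithm k A" "valid_input I"
  shows "feasible k I (A I)" "\<And>m. m < k \<Longrightarrow> machine_history (A I m)"
  using assms by (auto simp: online_algorithm_def feasible_def)

text \<open>The inequality is strict because an algorithm may react to a job at the very moment of
  its arrival.\<close>

lemma online_append:
  assumes "online_algorithm k A" "valid_input I" "valid_input (I @ [x])"
    and "t < arrival x" "m < k"
  shows "A (I @ [x]) m t = A I m t"
proof -
  have "filter (\<lambda>x. arrival x \<le> t) (I @ [x]) = filter (\<lambda>x. arrival x \<le> t) I"
    using assms by simp
  then show ?thesis using assms unfolding online_algorithm_def by blast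
qed

lemma online_job_machine:
  assumes "online_algorithm k A" "valid_input I" "j < length I"
  obtains m where "m < k" "emeasure lborel {t. A I m t = Busy j} = ennreal (work (I ! j))"
    "\<And>t. A I m t = Busy j \<Longrightarrow> arrival (I ! j) \<le> t \<and> t \<le> deadline (I ! j)" "0 < work (I ! j)"
proof -
  have "0 < work (I ! j)" using assms by (auto simp: valid_input_def)
  then show thesis
    using that online_feasible(1)[OF assms(1,2)] assms(3) unfolding feasible_def by blast
qed

lemma online_on_for_job:
  assumes "online_algorithm k A" "valid_input I" "j < length I"
  obtains m y where "m < k" "A I m y \<noteq> Sleep" "arrival (I ! j) \<le> y" "y < deadline (I ! j)"
proof -
  obtain m where m: "m < k" "emeasure lborel {t. A I m t = Busy j} = ennreal (work (I ! j))"
    "\<And>t. A I m t = Busy j \<Longrightarrow> arrival (I ! j) \<le> t \<and> t \<le> deadline (I ! j)" "0 < work (I ! j)"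
    using online_job_machine[OF assms] by blast
  show thesis using ex_busy_time[OF m(2,4,3)] that[OF m(1)] by (metis state.distinct(3))
qed

lemma locally_constant_right:
  fixes S :: schedule
  assumes "\<And>m. m < k \<Longrightarrow> machine_history (S m)"
  shows "\<exists>e>0. \<forall>u\<in>{t..<t + e}. \<forall>m<k. S m u = S m t"
  using assms
proof (induction k)
  case 0
  show ?case by (intro exI[of _ 1]) auto
next
  case (Suc k)
  obtain e where e: "e > 0" "\<forall>u\<in>{t..<t + e}. \<forall>m<k. S m u = S m t" using Suc by auto
  obtain e' where e': "e' > 0" "\<forall>u\<in>{t..<t + e'}. S k u = S k t"
    using machine_history_locally_constant_right[OF Suc.prems[of k], of t] by auto
  show ?case
  proof (intro exI conjI ballI allI impI)
    show "0 < min e e'" using e(1) e'(1) by simp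
    fix u m assume "u \<in> {t..<t + min e e'}" "m < Suc k"
    then have "u \<in> {t..<t + e}" "u \<in> {t..<t + e'}" "m = k \<or> m < k" by auto
    then show "S m u = S m t" using e(2) e'(2) by blast
  qed
qed

text \<open>The optimum, on exactly during \<open>[\<sigma>, T)\<close>, has spent \<open>1 + (T - \<sigma>)\<close>.\<close>

definition adversary_lead :: "(job list \<Rightarrow> schedule) \<Rightarrow> real \<Rightarrow> bool" where
  "adversary_lead A v \<longleftrightarrow> (\<exists>I \<sigma> T. valid_input I \<and> I \<noteq> [] \<and> (\<forall>x\<in>set I. arrival x \<le> T) \<and> 0 \<le> \<sigma> \<and>
     feasible_on_interval I \<sigma> T \<and>
     ennreal (2.1 * (1 + (T - \<sigma>)) + v) \<le> (\<Sum>m<2. energy_before T (A I m)))"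

text \<open>A positive real \<open>P\<close> in place of the optimum keeps the final division away
  from the corner cases of \<open>ennreal\<close>.\<close>

definition adversary_wins :: "(job list \<Rightarrow> schedule) \<Rightarrow> bool" where
  "adversary_wins A \<longleftrightarrow> (\<exists>I P. valid_input I \<and> I \<noteq> [] \<and> 0 < P \<and>
     opt_energy 1 1 1 I \<le> ennreal P \<and> ennreal (2.1 * P) \<le> energy 1 1 1 2 (A I))"

text \<open>The energy of the algorithm may be counted up to any time \<open>T'\<close>, in
  particular after the optimum has turned off for good at \<open>T\<close>.\<close>

lemma adversary_winsI:
  assumes "online_algorithm 2 A" "valid_input I" "I \<noteq> []" "feasible_on_interval I \<sigma> T"
    and "ennreal (2.1 * (1 + (T - \<sigma>))) \<le> (\<Sum>m<2. energy_before T' (A I m))"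
  shows "adversary_wins A"
proof -
  have "(\<Sum>m<2. energy_before T' (A I m)) \<le> energy 1 1 1 2 (A I)"
    unfolding energy_def using online_feasible[OF assms(1,2)]
    by (intro sum_mono energy_before_le) auto
  with assms(5) have "ennreal (2.1 * (1 + (T - \<sigma>))) \<le> energy 1 1 1 2 (A I)"
    by (rule order.trans)
  moreover have "0 < 1 + (T - \<sigma>)" using assms(4) by (simp add: feasible_on_interval_def)
  ultimately show ?thesis unfolding adversary_wins_def
    using assms opt_energy_le[OF assms(4)] by blast
qed

lemma adversary_lead_nonneg:
  assumes "online_algorithm 2 A" "adversary_lead A v" "0 \<le> v"
  shows "adversary_wins A"
proof -
  obtain I \<sigma> T where I: "valid_input I" "I \<noteq> []" "feasible_on_interval I \<sigma> T"
    and lead: "ennreal (2.1 * (1 + (T - \<sigma>)) + v) \<le> (\<Sum>m<2. energy_before T (A I m))"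
    using assms(2) unfolding adversary_lead_def by blast
  have "ennreal (2.1 * (1 + (T - \<sigma>))) \<le> ennreal (2.1 * (1 + (T - \<sigma>)) + v)"
    using assms(3) by (intro ennreal_leI) simp
  with lead show ?thesis by (intro adversary_winsI[OF assms(1) I]) (rule order.trans)
qed

text \<open>One ski-rental round. The term 0.042 is the error due to a gap and a job of length 0.01
  each, for which the optimum pays 0.02 and which counts 2.1 times.\<close>

lemma adversary_lead_step:
  assumes A: "online_algorithm 2 A" and "adversary_lead A v" "-1 \<le> v"
  shows "adversary_wins A \<or> adversary_lead A (1 + 2.1 * v - 0.042)"
proof (cases "0 \<le> v")
  case True
  then show ?thesis using adversary_lead_nonneg[OF A assms(2)] by simp
next
  case False
  obtain I \<sigma> T where I: "valid_input I" "I \<noteq> []" "feasible_on_interval I \<sigma> T"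
    and arr: "\<forall>x\<in>set I. arrival x \<le> T" and "0 \<le> \<sigma>"
    and lead: "ennreal (2.1 * (1 + (T - \<sigma>)) + v) \<le> (\<Sum>m<2. energy_before T (A I m))"
    using assms(2) unfolding adversary_lead_def by blast
  have "\<sigma> < T" using I(3) by (simp add: feasible_on_interval_def)
  \<comment> \<open>\<open>ennreal\<close> truncates negative reals to 0; the bound
    \<open>-1 \<le> v\<close> excludes this, so that the sums below may be split.\<close>
  have nonneg: "0 \<le> 2.1 * (1 + (T - \<sigma>)) + v"
    using \<open>\<sigma> < T\<close> \<open>-1 \<le> v\<close> by (simp add: field_simps)
  note hist = online_feasible(2)[OF A I(1)]
  have spent: "ennreal (2.1 * (1 + (T - \<sigma>)) + v + (w - T)) \<le> (\<Sum>m<2. energy_before w (A I m))"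
    if "T \<le> w" and on: "\<And>t. T \<le> t \<Longrightarrow> t < w \<Longrightarrow> \<exists>m<2. A I m t \<noteq> Sleep" for w
  proof -
    have "ennreal (2.1 * (1 + (T - \<sigma>)) + v + (w - T))
        = ennreal (2.1 * (1 + (T - \<sigma>)) + v) + ennreal (w - T)"
      using that nonneg by (intro ennreal_plus) auto
    also have "\<dots> \<le> (\<Sum>m<2. energy_before T (A I m)) + ennreal (w - T)"
      by (intro add_right_mono lead)
    also have "\<dots> \<le> (\<Sum>m<2. energy_before w (A I m))"
      by (rule sum_energy_before_on[of 2 "A I", OF hist that(1) on])
    finally show ?thesis .
  qed
  show ?thesis
  \<comment> \<open>If some machine is on at all times for \<open>-v\<close> after \<open>T\<close>,
    the algorithm has made up its deficit and no further job is released. Otherwise \<open>u\<close>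
    is the first time at which both machines are asleep.\<close>
  proof (cases "\<forall>t. T \<le> t \<longrightarrow> t < T - v \<longrightarrow> (\<exists>m<2. A I m t \<noteq> Sleep)")
    case True
    then have "ennreal (2.1 * (1 + (T - \<sigma>))) \<le> (\<Sum>m<2. energy_before (T - v) (A I m))"
      using spent[of "T - v"] False by simp
    then show ?thesis using adversary_winsI[OF A I] by blast
  next
    case off: False
    have right: "\<exists>e>0. \<forall>u\<in>{t..<t + e}. (\<forall>m<2. A I m u = Sleep) = (\<forall>m<2. A I m t = Sleep)" for t
      using locally_constant_right[of 2 "A I" t, OF hist] by metis
    obtain u where u: "T \<le> u" "u < T - v" "\<forall>m<2. A I m u = Sleep"
      "\<And>t. T \<le> t \<Longrightarrow> t < u \<Longrightarrow> \<not> (\<forall>m<2. A I m t = Sleep)"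
    proof -
      obtain u0 where u0: "T \<le> u0" "u0 < T - v" "\<forall>m<2. A I m u0 = Sleep" using off by blast
      show thesis
        by (rule first_time[of "\<lambda>t. \<forall>m<2. A I m t = Sleep" u0 T, OF u0(3,1) right])
          (use u0 that in auto)
    qed
    \<comment> \<open>The job arrives strictly after \<open>u\<close>, so the algorithm is asleep at
      \<open>u\<close> on the extended input too, and must turn on again before
      \<open>d\<close>.\<close>
    define a d where "a = u + 1/100" and "d = u + 2/100"
    let ?I = "I @ [tight_job a d]"
    have "T \<le> a" "a < d" "u < a" "0 \<le> T" using u \<open>0 \<le> \<sigma>\<close> \<open>\<sigma> < T\<close> by (auto simp: a_def d_def)
    have feas: "feasible_on_interval ?I \<sigma> d"
      by (rule feasible_on_interval_append) fact+
    have valid: "valid_input ?I"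
      using arr \<open>T \<le> a\<close> \<open>0 \<le> T\<close> \<open>a < d\<close>
      by (intro valid_input_append_tight_job[OF I(1) feas]) auto
    note hist' = online_feasible(2)[OF A valid]
    have same: "A ?I m t = A I m t" if "t < a" "m < 2" for m t
      using online_append[OF A I(1) valid] that by simp
    obtain m y where y: "m < 2" "A ?I m y \<noteq> Sleep" "a \<le> y" "y < d"
      using online_on_for_job[OF A valid, of "length I"] by auto
    \<comment> \<open>With \<open>z = u - T\<close>, the new lead is
      \<open>v + z + 1 - 2.1 * (z + 0.02)\<close>, and \<open>z < -v\<close>.\<close>
    have "ennreal (2.1 * (1 + (d - \<sigma>)) + (1 + 2.1 * v - 0.042))
        \<le> ennreal ((2.1 * (1 + (T - \<sigma>)) + v + (u - T)) + 1)"
      using u by (intro ennreal_leI) (simp add: d_def field_simps)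
    also have "\<dots> = ennreal (2.1 * (1 + (T - \<sigma>)) + v + (u - T)) + 1"
      using u nonneg by (subst ennreal_plus) auto
    also have "\<dots> \<le> (\<Sum>m<2. energy_before u (A I m)) + 1"
      using u by (intro add_right_mono spent) auto
    also have "\<dots> = (\<Sum>m<2. energy_before u (A ?I m)) + 1"
      using same \<open>u < a\<close> by (intro arg_cong2[of _ _ _ _ plus] sum.cong energy_before_cong) auto
    also have "\<dots> \<le> (\<Sum>m<2. energy_before d (A ?I m))"
      by (rule sum_energy_before_turn_on[of 2 "A ?I", OF hist' y(1) _ y(2), of u])
        (use y u same[of u m] \<open>u < a\<close> in auto)
    finally have "adversary_lead A (1 + 2.1 * v - 0.042)"
      unfolding adversary_lead_def using valid feas \<open>0 \<le> \<sigma>\<close> arr \<open>T \<le> a\<close> \<open>a < d\<close>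
      by (intro exI[of _ ?I] exI[of _ \<sigma>] exI[of _ d]) auto
    then show ?thesis ..
  qed
qed

text \<open>The opening job \<open>(0, 1, 0.01)\<close>.  If the algorithm first turns on at a time \<open>t \<le> 0.5\<close>, then it
  either idles until time 0.9, or turns off before and is then forced to turn on again; the
  optimum postpones the job.  If \<open>t > 0.5\<close>, a job that keeps a machine busy from shortly after \<open>t\<close>
  until time 1 does not fit together with the opening job, so that the algorithm turns on both
  machines; the optimum executes the opening job just before.\<close>

lemma adversary_opening:
  assumes A: "online_algorithm 2 A"
  shows "adversary_lead A (-0.74)"
proof -
  define j where "j = \<lparr>arrival = 0, deadline = 1, work = (1/100 :: real)\<rparr>"
  have j: "arrival j = 0" "deadline j = 1" "work j = 1/100" by (simp_all add: j_def)
  have feas: "feasible_on_interval [j] \<sigma> (\<sigma> + 1/100)" if "0 \<le> \<sigma>" "\<sigma> \<le> 99/100" for \<sigma>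
    using feasible_on_interval_single[of j \<sigma>] that by (simp add: j)
  have valid: "valid_input [j]"
    by (rule valid_input_if_feasible_on_interval[OF feas[of 0]]) (simp_all add: j)
  note hist = online_feasible(2)[OF A valid]
  have tight: "feasible_on_interval [j, tight_job a d] (a - 1/100) d" "valid_input [j, tight_job a d]"
    if "1/100 \<le> a" "a < d" "d \<le> 1" for a d
  proof -
    show "feasible_on_interval [j, tight_job a d] (a - 1/100) d"
      using feasible_on_interval_append[OF feas[of "a - 1/100"], of a d] that by simp
    then show "valid_input [j, tight_job a d]"
      using valid_input_append_tight_job[OF valid, of a d] that by (simp add: j)
  qed
  have same: "A [j, tight_job a d] m t = A [j] m t"
    if "1/100 \<le> a" "a < d" "d \<le> 1" "t < a" "m < 2" for a d m t
    using online_append[OF A valid, of "tight_job a d"] tight(2)[of a d] that by simp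
  have right: "\<exists>e>0. \<forall>u\<in>{t..<t + e}. (\<exists>m<2. A [j] m u \<noteq> Sleep) = (\<exists>m<2. A [j] m t \<noteq> Sleep)" for t
    using locally_constant_right[of 2 "A [j]" t, OF hist] by metis
  obtain m0 y where y: "m0 < 2" "A [j] m0 y \<noteq> Sleep" "0 \<le> y" "y < 1"
    using online_on_for_job[OF A valid, of 0] by (auto simp: j)
  then have "\<exists>m<2. A [j] m y \<noteq> Sleep" by blast
  then obtain t where "0 \<le> t" "t \<le> y" "\<exists>m<2. A [j] m t \<noteq> Sleep"
    and "\<And>u. 0 \<le> u \<Longrightarrow> u < t \<Longrightarrow> \<not> (\<exists>m<2. A [j] m u \<noteq> Sleep)"
    using first_time[of "\<lambda>t. \<exists>m<2. A [j] m t \<noteq> Sleep" y 0, OF _ \<open>0 \<le> y\<close> right] by blast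
  then obtain n where t: "0 \<le> t" "t \<le> y" "n < 2" "A [j] n t \<noteq> Sleep"
    and before: "\<And>u m. 0 \<le> u \<Longrightarrow> u < t \<Longrightarrow> m < 2 \<Longrightarrow> A [j] m u = Sleep" by blast
  have asleep: "A [j] m u = Sleep" if "u < t" "m < 2" for u m
    using before[of u m] hist[of m] that by (cases "u < 0") (auto simp: machine_history_def)
  have once: "1 \<le> (\<Sum>m<2. energy_before u (A [j] m))" if "t < u" for u
  proof -
    have "(0 :: ennreal) + 1 \<le> (\<Sum>m<2. energy_before (-1) (A [j] m)) + 1"
      by (intro add_right_mono) simp
    also have "\<dots> \<le> (\<Sum>m<2. energy_before u (A [j] m))"
      by (rule sum_energy_before_turn_on[of 2 "A [j]", OF hist t(3) _ t(4), of "-1"])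
        (use asleep[of "-1" n] t that in auto)
    finally show ?thesis by simp
  qed
  \<comment> \<open>The bound 9/10 leaves room before the deadline 1 for another gap and tight job
    after \<open>u\<close>.\<close>
  consider (late) "1/2 < t"
    | (off) u where "t < u" "u < 9/10" "\<forall>m<2. A [j] m u = Sleep"
    | (on) "t \<le> 1/2" "\<And>u. t \<le> u \<Longrightarrow> u < 9/10 \<Longrightarrow> \<exists>m<2. A [j] m u \<noteq> Sleep"
    using t by (metis linorder_not_le order_le_less)
  then show ?thesis
  proof cases
    case on
    \<comment> \<open>This case determines the constant: the algorithm has spent at least
      \<open>1 + 0.9 - 0.51 = 1.39\<close>, and \<open>1.39 - 2.1 * 1.01 = -0.731\<close>. The
      offset 1/100 after \<open>t\<close> lets the turn-on at \<open>t\<close> be counted as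
      strictly earlier.\<close>
    have "ennreal (2.1 * (1 + ((99/100 + 1/100) - 99/100)) + (-0.74))
        \<le> ennreal (1 + (9/10 - (t + 1/100)))"
      using on(1) by (intro ennreal_leI) simp
    also have "\<dots> = 1 + ennreal (9/10 - (t + 1/100))"
      using on(1) by (subst ennreal_plus) auto
    also have "\<dots> \<le> (\<Sum>m<2. energy_before (t + 1/100) (A [j] m)) + ennreal (9/10 - (t + 1/100))"
      by (intro add_right_mono once) simp
    also have "\<dots> \<le> (\<Sum>m<2. energy_before (9/10) (A [j] m))"
      by (rule sum_energy_before_on[of 2 "A [j]", OF hist]) (use on in auto)
    also have "\<dots> \<le> (\<Sum>m<2. energy_before (99/100 + 1/100) (A [j] m))"
      using hist by (intro sum_mono energy_before_mono) auto
    finally show ?thesis unfolding adversary_lead_def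
      using valid feas[of "99/100"]
      by (intro exI[of _ "[j]"] exI[of _ "99/100"] exI[of _ "99/100 + 1/100"]) (simp add: j)
  next
    case off
    \<comment> \<open>The optimum runs the opening job during \<open>[u, a)\<close> and the tight
      job during \<open>[a, d)\<close>. The two turn-ons of the algorithm alone suffice
      here.\<close>
    define a d where "a = u + 1/100" and "d = u + 2/100"
    let ?I = "[j, tight_job a d]"
    have ad: "1/100 \<le> a" "a < d" "d \<le> 1" "u < a" using off t by (auto simp: a_def d_def)
    note hist' = online_feasible(2)[OF A tight(2)[OF ad(1-3)]]
    obtain m z where z: "m < 2" "A ?I m z \<noteq> Sleep" "a \<le> z" "z < d"
      using online_on_for_job[OF A tight(2)[OF ad(1-3)], of 1] by auto
    have "ennreal (2.1 * (1 + (d - (a - 1/100))) + (-0.74)) \<le> ennreal 2"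
      by (intro ennreal_leI) (simp add: a_def d_def)
    also have "\<dots> = 1 + 1" by simp
    also have "\<dots> \<le> (\<Sum>m<2. energy_before u (A [j] m)) + 1"
      using off by (intro add_right_mono once)
    also have "\<dots> = (\<Sum>m<2. energy_before u (A ?I m)) + 1"
      using same[OF ad(1-3)] \<open>u < a\<close>
      by (intro arg_cong2[of _ _ _ _ plus] sum.cong energy_before_cong) auto
    also have "\<dots> \<le> (\<Sum>m<2. energy_before d (A ?I m))"
      by (rule sum_energy_before_turn_on[of 2 "A ?I", OF hist' z(1) _ z(2), of u])
        (use z off same[OF ad(1-4), of m] \<open>u < a\<close> in auto)
    finally show ?thesis unfolding adversary_lead_def
      using tight[OF ad(1-3)] ad
      by (intro exI[of _ ?I] exI[of _ "a - 1/100"] exI[of _ d]) (simp add: j)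
  next
    case late
    obtain m where m: "m < 2" "emeasure lborel {t. A [j] m t = Busy 0} = ennreal (1/100)"
      "\<And>t. A [j] m t = Busy 0 \<Longrightarrow> 0 \<le> t \<and> t \<le> 1"
      using online_job_machine[OF A valid, of 0] by (auto simp: j)
    \<comment> \<open>On the input \<open>[j]\<close> the opening job must fit between
      \<open>t\<close> and 1, so \<open>t\<close> is at most 0.99 and there is still time for a
      second job.\<close>
    have sub: "{u. A [j] m u = Busy 0} \<subseteq> {t..1}"
      using asleep[OF _ m(1)] m(3) by (auto simp: not_less[symmetric])
    have "ennreal (1/100) \<le> emeasure lborel {t..1}"
      unfolding m(2)[symmetric] using sub by (intro emeasure_mono) auto
    then have "t \<le> 99/100" using t y by (simp add: ennreal_le_iff)
    \<comment> \<open>The delay is half of the opening work: one machine, asleep before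
      \<open>t\<close>, would need \<open>1/100 + (1 - a)\<close>, which exceeds
      \<open>1 - t\<close> by 1/200.\<close>
    define a where "a = t + 1/200"
    let ?I = "[j, tight_job a 1]"
    have a: "1/100 \<le> a" "a < 1" "1 \<le> (1 :: real)" "t < a"
      using late \<open>t \<le> 99/100\<close> by (auto simp: a_def)
    note valid' = tight(2)[OF a(1-3)]
    note hist' = online_feasible(2)[OF A valid']
    have asleep': "A ?I m u = Sleep" if "u < t" "m < 2" for u m
      using asleep[OF that] same[OF a(1-3), of u m] that a(4) by simp
    obtain p where p: "p < 2" "emeasure lborel {t. A ?I p t = Busy 0} = ennreal (1/100)"
      "\<And>t. A ?I p t = Busy 0 \<Longrightarrow> 0 \<le> t \<and> t \<le> 1"
      using online_job_machine[OF A valid', of 0] by (auto simp: j)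
    obtain q where q: "q < 2" "emeasure lborel {t. A ?I q t = Busy 1} = ennreal (1 - a)"
      "\<And>t. A ?I q t = Busy 1 \<Longrightarrow> a \<le> t \<and> t \<le> 1"
      using online_job_machine[OF A valid', of 1] by auto
    have "p \<noteq> q"
    proof
      assume "p = q"
      let ?B = "\<lambda>i. {t. A ?I p t = Busy i}"
      have B: "?B i \<in> sets lborel" for i
        using sets_machine_history[OF hist'[OF p(1)], of "\<lambda>c. c = Busy i"] .
      have "u \<in> {t..1}" if "u \<in> ?B 0 \<union> ?B 1" for u
        using that asleep'[of u p] p(1,3) q(3) \<open>p = q\<close> by (cases "u < t") auto
      then have "emeasure lborel (?B 0 \<union> ?B 1) \<le> emeasure lborel {t..1}"
        by (intro emeasure_mono) auto
      moreover have "emeasure lborel (?B 0 \<union> ?B 1) = emeasure lborel (?B 0) + emeasure lborel (?B 1)"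
        using B by (intro plus_emeasure[symmetric]) auto
      ultimately have "ennreal (1/100) + ennreal (1 - a) \<le> ennreal (1 - t)"
        using p(2) q(2) \<open>p = q\<close> t y by simp
      then have "ennreal (1/100 + (1 - a)) \<le> ennreal (1 - t)"
        using a by (subst ennreal_plus) auto
      then show False using t y a(2) by (simp add: a_def ennreal_le_iff)
    qed
    \<comment> \<open>The lead is at least \<open>1.1 * t - 1.2055\<close>, which increases with
      \<open>t\<close> and is -0.6555 at \<open>t = 1/2\<close>.\<close>
    have "ennreal (2.1 * (1 + (1 - (a - 1/100))) + (-0.74)) \<le> ennreal ((1 + 1/100) + (1 + (1 - a)))"
      using late by (intro ennreal_leI) (simp add: a_def field_simps)
    also have "\<dots> = ennreal (1 + 1/100) + ennreal (1 + (1 - a))"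
      using a by (intro ennreal_plus) auto
    also have "\<dots> = (1 + ennreal (1/100)) + (1 + ennreal (1 - a))"
      using a by (intro arg_cong2[of _ _ _ _ plus]; subst ennreal_plus) auto
    also have "\<dots> \<le> energy_before 1 (A ?I p) + energy_before 1 (A ?I q)"
      using a(2)
      by (intro add_mono energy_before_busy[OF hist'[OF p(1)] p(2) _ p(3)]
          energy_before_busy[OF hist'[OF q(1)] q(2) _ q(3)]) auto
    also have "\<dots> = (\<Sum>m\<in>{p, q}. energy_before 1 (A ?I m))"
      using \<open>p \<noteq> q\<close> by simp
    also have "{p, q} = {..<2}" using p(1) q(1) \<open>p \<noteq> q\<close> by auto
    finally show ?thesis unfolding adversary_lead_def
      using tight[OF a(1-3)] a
      by (intro exI[of _ ?I] exI[of _ "a - 1/100"] exI[of _ 1]) (simp add: j)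
  qed
qed

text \<open>With the error 0.042 the fixed point of a round is \<open>-0.958/1.1\<close>, about
  -0.871. The opening lead -0.74 lies above it, and three rounds make it positive.\<close>

lemma adversary_wins:
  assumes A: "online_algorithm 2 A"
  shows "adversary_wins A"
proof (rule ccontr)
  assume lost: "\<not> adversary_wins A"
  have step: "adversary_lead A (1 + 2.1 * v - 0.042)" if "adversary_lead A v" "-1 \<le> v" for v
    using adversary_lead_step[OF A that] lost by blast
  have "adversary_lead A (-0.596)" using step[OF adversary_opening[OF A]] by simp
  from step[OF this] have "adversary_lead A (-0.2936)" by simp
  from step[OF this] have "adversary_lead A 0.34144" by simp
  from adversary_lead_nonneg[OF A this] lost show False by simp
qed

lemma ennreal_inverse_antimono:
  fixes x y :: ennreal
  assumes "x \<le> y"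
  shows "inverse y \<le> inverse x"
  using assms by (simp add: less_eq_ennreal.rep_eq inverse_ennreal.rep_eq ereal_inverse_antimono)

theorem theorem5:
  fixes A :: "job list \<Rightarrow> schedule"
  assumes "online_algorithm 2 A"
  shows "competitive_ratio 1 1 1 2 A \<ge> ennreal 2.1 \<and>
    (\<exists>I. valid_input I \<and> I \<noteq> [] \<and>
       energy 1 1 1 2 (A I) \<ge> ennreal 2.1 * opt_energy 1 1 1 I)"
proof -
  obtain I P where I: "valid_input I" "I \<noteq> []" and P: "0 < P"
    "opt_energy 1 1 1 I \<le> ennreal P" "ennreal (2.1 * P) \<le> energy 1 1 1 2 (A I)"
    using adversary_wins[OF assms] unfolding adversary_wins_def by blast
  have "ennreal 2.1 * opt_energy 1 1 1 I \<le> ennreal 2.1 * ennreal P"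
    by (intro mult_left_mono P) simp
  also have "\<dots> = ennreal (2.1 * P)" using P(1) by (subst ennreal_mult) auto
  also note P(3)
  finally have *: "ennreal 2.1 * opt_energy 1 1 1 I \<le> energy 1 1 1 2 (A I)" .
  \<comment> \<open>Both replacements increase the quotient: a larger numerator, and the optimum in
    place of its upper bound \<open>P\<close>.\<close>
  have "ennreal 2.1 = ennreal (2.1 * P) / ennreal P"
    using P(1) by (subst divide_ennreal) auto
  also have "\<dots> \<le> energy 1 1 1 2 (A I) / opt_energy 1 1 1 I"
    unfolding divide_ennreal_def using P by (intro mult_mono ennreal_inverse_antimono) simp_all
  also have "\<dots> \<le> competitive_ratio 1 1 1 2 A"
    unfolding competitive_ratio_def using I by (intro SUP_upper) auto
  finally show ?thesis using * I by blast
qed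

end
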